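(* Let $Q\in\mathcal{F}_2$, let $S\in\mathbb{R}^{n\times n}$ be a symmetric, stochastic matrix with positive diagonal, and put $S_k=S$ and $T_k(x):=S_kQ(x)=SQ(x)$ for all $x\in\mathbb{R}^n$ and $k\ge 0$. Then: (1) $Q$ and all the operators $S_k$ are strictly nonexpansive; (2) $F:=\bigcap_{k=0}^{\infty}\{x\in\mathbb{R}^n\mid T_k(x)=x\}\neq\emptyset$; (3) for any sequence $\{x^k\}_{k=0}^{\infty}$ generated by $x^0\in\mathbb{R}^n$ arbitrary and $x^{k+1}=T_{k+1}(x^k)$, $k\ge 0$, and for every $\ell\ge 0$, there exists $k(\ell)\ge 0$ such that $\|T_{k+1}(x^k)-z\|\le\|T_\ell(x^k)-z\|$ for all $z\in F$ and all $k\ge k(\ell)$.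
   Context: $\|\cdot\|$ and $\langle\cdot,\cdot\rangle$ are the Euclidean norm and scalar product on $\mathbb{R}^n$. An operator $T:\mathbb{R}^n\to\mathbb{R}^n$ is strictly nonexpansive if for all $x,y\in\mathbb{R}^n$: (i) $\|T(x)-T(y)\|\le\|x-y\|$, and (ii) if $\|T(x)-T(y)\|=\|x-y\|$ then $T(x)-T(y)=x-y$. A stochastic matrix is one with nonnegative entries whose rows each sum to $1$. $\mathcal{F}_1$ is the set of continuous operators $Q:\mathbb{R}^n\to\mathbb{R}^n$ such that for all $x,y\in\mathbb{R}^n$: $\|Q(x)-Q(y)\|\le\|x-y\|$; and if $\|Q(x)-Q(y)\|=\|x-y\|$, then $Q(x)-Q(y)=x-y$ and $\langle x-y,Q(y)-y\rangle=0$. $\mathcal{F}_2$ is the set of operators $Q\in\mathcal{F}_1$ such that for all $S\in\mathbb{R}^{n\times n}$ the function $g:\mathbb{R}^n\to\mathbb{R}$, $g(x):=\|x-SQ(x)\|^2$, attains its unconstrained global minimum. *)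

theory Defs
  imports "HOL-Analysis.Analysis"
begin

definition strictly_nonexpansive :: "('a::euclidean_space \<Rightarrow> 'a) \<Rightarrow> bool" where
  "strictly_nonexpansive T \<longleftrightarrow>
     (\<forall>x y. norm (T x - T y) \<le> norm (x - y) \<and>
            (norm (T x - T y) = norm (x - y) \<longrightarrow> T x - T y = x - y))"

definition stochastic_matrix :: "real^'n^'n \<Rightarrow> bool" where
  "stochastic_matrix S \<longleftrightarrow>
     (\<forall>i j. 0 \<le> S $ i $ j) \<and> (\<forall>i. (\<Sum>j\<in>UNIV. S $ i $ j) = 1)"

definition class_F1 :: "(real^'n \<Rightarrow> real^'n) set" where
  "class_F1 =
     {Q. continuous_on UNIV Q \<and>
         (\<forall>x y. norm (Q x - Q y) \<le> norm (x - y) \<and>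
                (norm (Q x - Q y) = norm (x - y) \<longrightarrow>
                   Q x - Q y = x - y \<and> inner (x - y) (Q y - y) = 0))}"

definition class_F2 :: "(real^'n \<Rightarrow> real^'n) set" where
  "class_F2 =
     {Q \<in> class_F1. \<forall>S :: real^'n^'n.
        \<exists>x. \<forall>y. (norm (x - S *v Q x))\<^sup>2 \<le> (norm (y - S *v Q y))\<^sup>2}"

end

(* Fixed points: let x minimize |x - T x| with T = S Q. Nonexpansiveness makes T x a minimizer too, so
   both Q and S preserve the length of d = x - T x; strictness gives S d = d and the orthogonality in the
   first class gives <d, Q x - x> = 0. By symmetry of S,
   |d|^2 = <d, x> - <S d, Q x> = <d, x - Q x> = 0. *)
theory Submission
  imports Defs
begin

lemma norm_power2_vec: "(norm (x :: real^'n))\<^sup>2 = (\<Sum>i\<in>UNIV. (x $ i)\<^sup>2)"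
  unfolding power2_norm_eq_inner inner_vec_def by (simp add: power2_eq_square)

text \<open>For probability weights \<open>w\<close> with mean \<open>m\<close>, the second moment
  is \<open>m\<^sup>2\<close> plus the variance. The variance is a sum of nonnegative terms, so it
  dominates its \<open>i\<close>-th term alone.\<close>

lemma weighted_variance_diag_le:
  fixes w x :: "'i::finite \<Rightarrow> real"
  assumes nonneg: "\<And>j. 0 \<le> w j" and sum1: "(\<Sum>j\<in>UNIV. w j) = 1"
    and m: "m = (\<Sum>j\<in>UNIV. w j * x j)"
  shows "m\<^sup>2 + w i * (x i - m)\<^sup>2 \<le> (\<Sum>j\<in>UNIV. w j * (x j)\<^sup>2)"
proof -
  have "w i * (x i - m)\<^sup>2 \<le> (\<Sum>j\<in>UNIV. w j * (x j - m)\<^sup>2)"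
    by (rule member_le_sum) (auto simp: nonneg)
  also have "\<dots> = (\<Sum>j\<in>UNIV. w j * (x j)\<^sup>2 - 2 * m * (w j * x j) + m\<^sup>2 * w j)"
    by (rule sum.cong) (auto simp: power2_eq_square algebra_simps)
  also have "\<dots> = (\<Sum>j\<in>UNIV. w j * (x j)\<^sup>2) - 2 * m * m + m\<^sup>2 * 1"
    unfolding sum.distrib sum_subtractf sum_distrib_left[symmetric] m[symmetric] sum1 ..
  finally show ?thesis by (simp add: power2_eq_square)
qed

text \<open>Row \<open>i\<close> of \<open>S\<close> is a probability weight whose mean of
  \<open>x\<close> is \<open>(S *v x) $ i\<close>, so the variance bound applies to each row with
  its diagonal term kept. Symmetry makes the columns sum to 1 as well, hence the second moments of
  all rows add up to the squared norm of \<open>x\<close>. The diagonal sum is retained to control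
  the case of equality.\<close>

lemma symmetric_stochastic_norm_le:
  fixes S :: "real^'n^'n"
  assumes sym: "transpose S = S" and stoch: "stochastic_matrix S"
  shows "(norm (S *v x))\<^sup>2 + (\<Sum>i\<in>UNIV. S $ i $ i * (x $ i - (S *v x) $ i)\<^sup>2) \<le> (norm x)\<^sup>2"
proof -
  have nonneg: "\<And>i j. 0 \<le> S $ i $ j" and row: "\<And>i. (\<Sum>j\<in>UNIV. S $ i $ j) = 1"
    using stoch by (auto simp: stochastic_matrix_def)
  have "S $ i $ j = S $ j $ i" for i j
    using sym by (metis transpose_def vec_lambda_beta)
  then have col: "(\<Sum>i\<in>UNIV. S $ i $ j) = 1" for j
    using row[of j] by simp
  have "(norm (S *v x))\<^sup>2 + (\<Sum>i\<in>UNIV. S $ i $ i * (x $ i - (S *v x) $ i)\<^sup>2)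
      = (\<Sum>i\<in>UNIV. ((S *v x) $ i)\<^sup>2 + S $ i $ i * (x $ i - (S *v x) $ i)\<^sup>2)"
    by (simp add: norm_power2_vec sum.distrib)
  also have "\<dots> \<le> (\<Sum>i\<in>UNIV. \<Sum>j\<in>UNIV. S $ i $ j * (x $ j)\<^sup>2)"
    by (intro sum_mono weighted_variance_diag_le nonneg row) (simp add: matrix_vector_mult_def)
  also have "\<dots> = (\<Sum>j\<in>UNIV. (\<Sum>i\<in>UNIV. S $ i $ j) * (x $ j)\<^sup>2)"
    by (subst sum.swap) (simp add: sum_distrib_right)
  also have "\<dots> = (norm x)\<^sup>2"
    by (simp add: col norm_power2_vec)
  finally show ?thesis .
qed

text \<open>By linearity it suffices to compare \<open>S *v x\<close> with \<open>x\<close> for a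
  single vector. If the norms agree, the diagonal sum in the previous bound must vanish, and a
  positive diagonal then forces every coordinate of \<open>x\<close> to be fixed.\<close>

lemma strictly_nonexpansive_symmetric_stochastic:
  fixes S :: "real^'n^'n"
  assumes sym: "transpose S = S" and stoch: "stochastic_matrix S" and diag: "\<And>i. 0 < S $ i $ i"
  shows "strictly_nonexpansive (\<lambda>x. S *v x)"
proof -
  note le = symmetric_stochastic_norm_le[OF sym stoch]
  have nonneg: "0 \<le> S $ i $ i * (x $ i - (S *v x) $ i)\<^sup>2" for x i
    using diag[of i] by simp
  have ne: "norm (S *v x) \<le> norm x" for x
  proof -
    have "(norm (S *v x))\<^sup>2 \<le> (norm x)\<^sup>2"
      using le[of x] sum_nonneg[of UNIV "\<lambda>i. S $ i $ i * (x $ i - (S *v x) $ i)\<^sup>2", OF nonneg]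
      by linarith
    then show ?thesis by (rule power2_le_imp_le) simp
  qed
  have eq: "S *v x = x" if "norm (S *v x) = norm x" for x
  proof -
    have "(\<Sum>i\<in>UNIV. S $ i $ i * (x $ i - (S *v x) $ i)\<^sup>2) \<le> 0"
      using le[of x] that by simp
    then have "(\<Sum>i\<in>UNIV. S $ i $ i * (x $ i - (S *v x) $ i)\<^sup>2) = 0"
      by (intro antisym sum_nonneg nonneg)
    then have "S $ i $ i * (x $ i - (S *v x) $ i)\<^sup>2 = 0" for i
      by (subst (asm) sum_nonneg_eq_0_iff) (use nonneg in auto)
    then have "x $ i = (S *v x) $ i" for i
      using diag[of i] by (metis eq_iff_diff_eq_0 less_irrefl mult_eq_0_iff zero_eq_power2)
    then show ?thesis by (simp add: vec_eq_iff)
  qed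
  show ?thesis
    unfolding strictly_nonexpansive_def
    using ne eq by (simp add: matrix_vector_mult_diff_distrib[symmetric])
qed

lemma class_F2_fixed_point:
  fixes S :: "real^'n^'n"
  assumes Q: "Q \<in> class_F2" and sym: "transpose S = S"
    and ne: "strictly_nonexpansive (\<lambda>x. S *v x)"
  shows "\<exists>x. S *v Q x = x"
proof -
  have Q1: "norm (Q x - Q y) \<le> norm (x - y)"
    and Q2: "norm (Q x - Q y) = norm (x - y) \<Longrightarrow> Q x - Q y = x - y"
    and Q3: "norm (Q x - Q y) = norm (x - y) \<Longrightarrow> inner (x - y) (Q y - y) = 0" for x y
    using Q by (auto simp: class_F2_def class_F1_def)
  have S1: "norm (S *v x - S *v y) \<le> norm (x - y)"
    and S2: "norm (S *v x - S *v y) = norm (x - y) \<Longrightarrow> S *v x - S *v y = x - y" for x y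
    using ne by (auto simp: strictly_nonexpansive_def)
  obtain x where "\<And>y. (norm (x - S *v Q x))\<^sup>2 \<le> (norm (y - S *v Q y))\<^sup>2"
    using Q by (auto simp: class_F2_def)
  then have min: "norm (x - S *v Q x) \<le> norm (y - S *v Q y)" for y
    by (meson norm_ge_zero power2_le_imp_le)
  define y where "y = S *v Q x"
  define d where "d = x - y"
  \<comment> \<open>Minimality is tested at the image \<open>y\<close> of the minimizer, whose own
    displacement is \<open>S *v Q x - S *v Q y\<close>.\<close>
  have "norm d \<le> norm (S *v Q x - S *v Q y)"
    using min[of y] by (simp add: y_def d_def)
  \<comment> \<open>Together with nonexpansiveness of \<open>S\<close> and \<open>Q\<close> this
    closes a chain of inequalities that starts and ends at \<open>norm d\<close>, so every link is
    an equality.\<close>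
  with S1[of "Q x" "Q y"] Q1[of x y]
  have eqQ: "norm (Q x - Q y) = norm (x - y)"
    and eqS: "norm (S *v Q x - S *v Q y) = norm (Q x - Q y)"
    unfolding d_def by linarith+
  have "S *v d = d"
    using S2[OF eqS] Q2[OF eqQ] by (simp add: d_def matrix_vector_mult_diff_distrib[symmetric])
  then have "inner d (S *v Q x) = inner d (Q x)"
    using dot_lmul_matrix[of d S "Q x"] sym by (metis transpose_matrix_vector)
  \<comment> \<open>The orthogonality condition is taken with the two points exchanged, so that the
    residual \<open>Q x - x\<close> sits at the minimizer \<open>x\<close> rather than at
    \<open>y\<close>.\<close>
  moreover have "inner (y - x) (Q x - x) = 0"
    using Q3[of y x] eqQ by (simp add: norm_minus_commute)
  ultimately have "inner d d = 0"
    by (simp add: d_def y_def inner_diff_left inner_diff_right)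
  then have "S *v Q x = x" by (simp add: d_def y_def)
  then show ?thesis ..
qed

theorem mainTheorem3:
  fixes Q :: "real^'n \<Rightarrow> real^'n"
    and S :: "real^'n^'n"
    and Sk :: "nat \<Rightarrow> real^'n^'n"
    and T :: "nat \<Rightarrow> real^'n \<Rightarrow> real^'n"
    and F :: "(real^'n) set"
  assumes Q_F2: "Q \<in> class_F2"
    and S_sym: "transpose S = S"
    and S_stoch: "stochastic_matrix S"
    and S_diag: "\<And>i. 0 < S $ i $ i"
    and Sk_eq: "\<And>k. Sk k = S"
    and T_eq: "\<And>k x. T k x = Sk k *v Q x"
    and F_eq: "F = (\<Inter>k. {x. T k x = x})"
  shows "(strictly_nonexpansive Q \<and> (\<forall>k. strictly_nonexpansive (\<lambda>x. Sk k *v x))) \<and>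
         F \<noteq> {} \<and>
         (\<forall>x :: nat \<Rightarrow> real^'n. (\<forall>k. x (Suc k) = T (Suc k) (x k)) \<longrightarrow>
            (\<forall>l. \<exists>K. \<forall>z\<in>F. \<forall>k\<ge>K.
               norm (T (Suc k) (x k) - z) \<le> norm (T l (x k) - z)))"
proof (intro conjI)
  have ne: "strictly_nonexpansive (\<lambda>x. S *v x)"
    by (rule strictly_nonexpansive_symmetric_stochastic[OF S_sym S_stoch S_diag])
  show "strictly_nonexpansive Q"
    using Q_F2 by (auto simp: strictly_nonexpansive_def class_F2_def class_F1_def)
  show "\<forall>k. strictly_nonexpansive (\<lambda>x. Sk k *v x)"
    using ne by (simp add: Sk_eq)
  show "F \<noteq> {}"
    using class_F2_fixed_point[OF Q_F2 S_sym ne] by (auto simp: F_eq T_eq Sk_eq)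
  \<comment> \<open>All the operators \<open>T k\<close> coincide, so both distances are equal for
    every index and any \<open>K\<close> will do.\<close>
  show "\<forall>x :: nat \<Rightarrow> real^'n. (\<forall>k. x (Suc k) = T (Suc k) (x k)) \<longrightarrow>
      (\<forall>l. \<exists>K. \<forall>z\<in>F. \<forall>k\<ge>K. norm (T (Suc k) (x k) - z) \<le> norm (T l (x k) - z))"
    by (simp add: T_eq Sk_eq)
qed

end
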